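(* For $n\ge1$ let $c_n$ be the maximal real number $c$ such that the $n\times n$ matrix $$\left[2\min\{i,j\}-c-c\,\delta_{ij}\right]_{i,j=1}^n$$ is positive semidefinite. Then $\mathrm{QEC}(P_{n+1})=-c_n$.
   Context: $\delta_{ij}$ is the Kronecker delta. For $n\ge1$, $P_n$ is the path graph with vertex set $\{0,1,\dots,n-1\}$ and edge set $\{\{0,1\},\{1,2\},\dots,\{n-2,n-1\}\}$. For a connected graph $G=(V,E)$, $d(x,y)$ denotes the graph distance and $D=[d(x,y)]_{x,y\in V}$ the distance matrix. $C_0(V)$ is the space of real-valued functions on $V$ with finite support, $\langle f,g\rangle=\sum_{x\in V}f(x)g(x)$, $\langle \mathbf 1,f\rangle=\sum_{x\in V}f(x)$. The QE constant is $\mathrm{QEC}(G)=\sup\{\langle f,Df\rangle : f\in C_0(V),\ \langle f,f\rangle=1,\ \langle\mathbf 1,f\rangle=0\}$. *)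

theory Defs
  imports "HOL-Library.Extended_Real" "Jordan_Normal_Form.Matrix"
begin

subsection \<open>Graphs and distance\<close>

text \<open>A graph is a pair of a vertex set and a set of edges, each edge a two-element set of vertices.\<close>

type_synonym 'a graph = "'a set \<times> 'a set set"

abbreviation verts :: "'a graph \<Rightarrow> 'a set" where "verts G \<equiv> fst G"
abbreviation edges :: "'a graph \<Rightarrow> 'a set set" where "edges G \<equiv> snd G"

text \<open>A walk is given by its list of vertices, so a walk \<open>xs\<close> has \<open>length xs - 1\<close> edges.\<close>

definition is_walk :: "'a graph \<Rightarrow> 'a list \<Rightarrow> bool" where
  "is_walk G xs \<longleftrightarrow> xs \<noteq> [] \<and> set xs \<subseteq> verts G \<and>
     (\<forall>i. Suc i < length xs \<longrightarrow> {xs ! i, xs ! Suc i} \<in> edges G)"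

definition walk_between :: "'a graph \<Rightarrow> 'a \<Rightarrow> 'a list \<Rightarrow> 'a \<Rightarrow> bool" where
  "walk_between G x xs y \<longleftrightarrow> is_walk G xs \<and> hd xs = x \<and> last xs = y"

definition connected_graph :: "'a graph \<Rightarrow> bool" where
  "connected_graph G \<longleftrightarrow> verts G \<noteq> {} \<and>
     (\<forall>e\<in>edges G. e \<subseteq> verts G \<and> card e = 2) \<and>
     (\<forall>x\<in>verts G. \<forall>y\<in>verts G. \<exists>xs. walk_between G x xs y)"

text \<open>Meaningful only if \<open>x\<close> and \<open>y\<close> are joined by a walk; always so in a connected graph.\<close>

definition graph_dist :: "'a graph \<Rightarrow> 'a \<Rightarrow> 'a \<Rightarrow> nat" where
  "graph_dist G x y = (LEAST k. \<exists>xs. walk_between G x xs y \<and> length xs = Suc k)"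

subsection \<open>The QE constant\<close>

text \<open>Functions on the vertex set \<open>V\<close> are represented by functions on the whole type that
  vanish outside \<open>V\<close>.\<close>

definition finsupp :: "'a set \<Rightarrow> ('a \<Rightarrow> real) set" where
  "finsupp V = {f. finite {x. f x \<noteq> 0} \<and> {x. f x \<noteq> 0} \<subseteq> V}"

text \<open>\<^const>\<open>sum'\<close> adds up the nonzero terms, provided there are only finitely many of them; hence
  the sums below are the intended ones also for infinite \<open>V\<close>, as soon as one of the two
  functions (for \<open>dist_op\<close>, the function \<open>f\<close>) has finite support.\<close>

definition inner_on :: "'a set \<Rightarrow> ('a \<Rightarrow> real) \<Rightarrow> ('a \<Rightarrow> real) \<Rightarrow> real" where
  "inner_on V f g = sum' (\<lambda>x. f x * g x) V"

definition dist_op :: "'a graph \<Rightarrow> ('a \<Rightarrow> real) \<Rightarrow> 'a \<Rightarrow> real" where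
  "dist_op G f x = sum' (\<lambda>y. real (graph_dist G x y) * f y) (verts G)"

text \<open>The supremum is taken in the extended reals, so that no boundedness has to be presupposed.\<close>

definition QEC :: "'a graph \<Rightarrow> ereal" where
  "QEC G = Sup {ereal (inner_on (verts G) f (dist_op G f)) | f.
     f \<in> finsupp (verts G) \<and> inner_on (verts G) f f = 1 \<and> inner_on (verts G) (\<lambda>_. 1) f = 0}"

subsection \<open>Path graphs\<close>

definition path_graph :: "nat \<Rightarrow> nat graph" where
  "path_graph n = ({0..<n}, {{i, Suc i} | i. Suc i < n})"

lemma connected_path_graph:
  assumes "n \<ge> 1"
  shows "connected_graph (path_graph n)"
proof -
  have up: "walk_between (path_graph n) i [i..<Suc j] j" if "i \<le> j" "j < n" for i j
    using that unfolding walk_between_def is_walk_def path_graph_def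
    by (auto simp: nth_append hd_append le_less_Suc_eq simp del: upt_Suc)
  have down: "walk_between (path_graph n) j (rev [i..<Suc j]) i" if "i \<le> j" "j < n" for i j
    using that unfolding walk_between_def is_walk_def path_graph_def
  proof (auto simp: last_rev hd_rev rev_nth simp del: upt_Suc, goal_cases)
    case (1 k)
    then show ?case
      by (intro exI[of _ "j - Suc k"]) auto
  qed
  have "\<exists>xs. walk_between (path_graph n) i xs j" if "i < n" "j < n" for i j
    using up[of i j] down[of j i] that by (cases "i \<le> j") auto
  with assms show ?thesis
    by (auto simp: connected_graph_def path_graph_def)
qed

subsection \<open>Positive semidefinite matrices\<close>

definition pos_semidef :: "real mat \<Rightarrow> bool" where
  "pos_semidef A \<longleftrightarrow> square_mat A \<and> transpose_mat A = A \<and>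
     (\<forall>v\<in>carrier_vec (dim_row A). v \<bullet> (A *\<^sub>v v) \<ge> 0)"

text \<open>Rows and columns are numbered from \<open>0\<close>, while the entries are given by a formula in the
  indices \<open>1, \<dots>, n\<close>; hence the shift by one.\<close>

definition min_mat :: "nat \<Rightarrow> real \<Rightarrow> real mat" where
  "min_mat n c = mat n n (\<lambda>(i, j). 2 * real (min (i + 1) (j + 1)) - c - c * of_bool (i = j))"

definition path_const :: "nat \<Rightarrow> real" where
  "path_const n = (GREATEST c. pos_semidef (min_mat n c))"

end

theory Submission
  imports Defs
begin

text \<open>
  On a path the distance is \<open>\<bar>x - y\<bar> = x + y - 2 min x y\<close>, and for a function \<open>f\<close> with zero sum
  the terms \<open>x\<close> and \<open>y\<close> contribute nothing to \<open>\<langle>f, D f\<rangle>\<close>. So \<open>\<langle>f, D f\<rangle>\<close> is \<open>-2\<close> times the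
  form with matrix \<open>min x y\<close>, in which the vertex \<open>0\<close> does not occur (\<open>path_dist_form\<close>).
  The condition of zero sum is solved by letting the values \<open>g\<close> of \<open>f\<close> on the vertices
  \<open>1, \<dots>, n\<close> be arbitrary and putting minus their sum at the vertex \<open>0\<close>; under this
  parametrization \<open>\<langle>f, f\<rangle>\<close> becomes a form \<open>norm_form\<close> with matrix \<open>1 + \<delta>\<^sub>i\<^sub>j\<close> (\<open>path_norm_form\<close>).

  Hence the matrix of the theorem is that of \<open>2 min_form - c norm_form\<close>, and by homogeneity it is
  positive semidefinite iff \<open>c\<close> is a lower bound of the values of \<open>2 min_form\<close> on the
  \<open>norm_form\<close>-unit sphere (\<open>pos_semidef_min_mat_iff_sphere\<close>). These values are the negatives of
  those whose supremum is the QE constant. They are bounded below because \<open>min_form\<close> is a sum of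
  squares, so their infimum is at the same time the largest admissible \<open>c\<close> and minus the QE
  constant. No compactness argument is needed: a lower bound need not be attained to be greatest.
\<close>

section \<open>Distances in a path\<close>

text \<open>A walk moves by one at each step, so it cannot outrun its number of steps.\<close>

lemma path_walk_displacement:
  assumes "is_walk (path_graph n) xs" "k < length xs"
  shows "\<bar>real (xs ! k) - real (xs ! 0)\<bar> \<le> real k"
  using assms(2)
proof (induction k)
  case (Suc k)
  have "{xs ! k, xs ! Suc k} \<in> edges (path_graph n)"
    using assms(1) Suc.prems by (auto simp: is_walk_def)
  then have "xs ! Suc k = Suc (xs ! k) \<or> xs ! k = Suc (xs ! Suc k)"
    by (auto simp: path_graph_def doubleton_eq_iff)
  then have "\<bar>real (xs ! Suc k) - real (xs ! k)\<bar> \<le> 1"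
    by auto
  with Suc show ?case by simp
qed simp

lemma path_monotone_walks:
  assumes "i \<le> j" "j < n"
  shows "walk_between (path_graph n) i [i..<Suc j] j"
    and "walk_between (path_graph n) j (rev [i..<Suc j]) i"
proof -
  show "walk_between (path_graph n) i [i..<Suc j] j"
    using assms unfolding walk_between_def is_walk_def path_graph_def
    by (auto simp: nth_append hd_append le_less_Suc_eq simp del: upt_Suc)
  show "walk_between (path_graph n) j (rev [i..<Suc j]) i"
    using assms unfolding walk_between_def is_walk_def path_graph_def
  proof (auto simp: last_rev hd_rev rev_nth simp del: upt_Suc, goal_cases)
    case (1 k)
    then show ?case
      by (intro exI[of _ "j - Suc k"]) auto
  qed
qed

lemma graph_dist_path:
  assumes "x < n" "y < n"
  shows "real (graph_dist (path_graph n) x y) = \<bar>real x - real y\<bar>"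
proof -
  have "graph_dist (path_graph n) x y = max x y - min x y"
    unfolding graph_dist_def
  proof (rule Least_equality)
    show "\<exists>xs. walk_between (path_graph n) x xs y \<and> length xs = Suc (max x y - min x y)"
    proof (cases "x \<le> y")
      case True
      with path_monotone_walks(1)[of x y n] assms show ?thesis
        by (intro exI[of _ "[x..<Suc y]"]) (auto simp del: upt_Suc)
    next
      case False
      with path_monotone_walks(2)[of y x n] assms show ?thesis
        by (intro exI[of _ "rev [y..<Suc x]"]) (auto simp del: upt_Suc)
    qed
  next
    fix k
    assume "\<exists>xs. walk_between (path_graph n) x xs y \<and> length xs = Suc k"
    then obtain xs where xs: "is_walk (path_graph n) xs" "hd xs = x" "last xs = y"
      "length xs = Suc k"
      by (auto simp: walk_between_def)
    then have "xs \<noteq> []" by auto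
    then have "xs ! 0 = x" "xs ! k = y"
      using xs by (auto simp: hd_conv_nth last_conv_nth)
    with path_walk_displacement[OF xs(1), of k] xs(4) show "max x y - min x y \<le> k"
      by auto
  qed
  then show ?thesis by auto
qed

section \<open>The two quadratic forms\<close>

definition min_form :: "nat \<Rightarrow> (nat \<Rightarrow> real) \<Rightarrow> real" where
  "min_form n g = (\<Sum>i<n. \<Sum>j<n. real (min (i + 1) (j + 1)) * g i * g j)"

definition norm_form :: "nat \<Rightarrow> (nat \<Rightarrow> real) \<Rightarrow> real" where
  "norm_form n g = (\<Sum>i<n. g i)\<^sup>2 + (\<Sum>i<n. (g i)\<^sup>2)"

lemma min_form_scale: "min_form n (\<lambda>i. a * g i) = a\<^sup>2 * min_form n g"
  by (simp add: min_form_def sum_distrib_left power2_eq_square mult_ac)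

lemma norm_form_scale: "norm_form n (\<lambda>i. a * g i) = a\<^sup>2 * norm_form n g"
  by (simp add: norm_form_def sum_distrib_left[symmetric] power_mult_distrib distrib_left)

lemma norm_form_nonneg: "norm_form n g \<ge> 0"
  by (simp add: norm_form_def sum_nonneg)

text \<open>The number \<open>min (i + 1) (j + 1)\<close> counts the \<open>k\<close> with \<open>k \<le> i\<close> and \<open>k \<le> j\<close>; summing over
  \<open>k\<close> last turns the form into a sum of squares of tail sums of \<open>g\<close>.\<close>

lemma min_form_nonneg: "min_form n g \<ge> 0"
proof -
  have min: "real (min (i + 1) (j + 1)) = (\<Sum>k<n. of_bool (k \<le> i) * of_bool (k \<le> j))"
    if "i < n" "j < n" for i j
  proof -
    have "(\<Sum>k<n. of_bool (k \<le> i) * of_bool (k \<le> j)) = (\<Sum>k<n. of_bool (k \<in> {..min i j}) :: real)"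
      by (intro sum.cong) auto
    also have "\<dots> = real (card ({..<n} \<inter> {..min i j}))"
      by (simp add: Int_def)
    also have "{..<n} \<inter> {..min i j} = {..min i j}"
      using that by auto
    finally show ?thesis by simp
  qed
  have "min_form n g =
      (\<Sum>i<n. \<Sum>j<n. \<Sum>k<n. (of_bool (k \<le> i) * g i) * (of_bool (k \<le> j) * g j))"
    unfolding min_form_def
    by (intro sum.cong refl) (simp only: min lessThan_iff sum_distrib_right, simp only: mult_ac)
  also have "\<dots> = (\<Sum>i<n. \<Sum>k<n. \<Sum>j<n. (of_bool (k \<le> i) * g i) * (of_bool (k \<le> j) * g j))"
    by (intro sum.cong refl sum.swap)
  also have "\<dots> = (\<Sum>k<n. \<Sum>i<n. \<Sum>j<n. (of_bool (k \<le> i) * g i) * (of_bool (k \<le> j) * g j))"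
    by (rule sum.swap)
  also have "\<dots> = (\<Sum>k<n. (\<Sum>i<n. of_bool (k \<le> i) * g i)\<^sup>2)"
    by (simp only: power2_eq_square sum_product)
  also have "\<dots> \<ge> 0"
    by (simp add: sum_nonneg)
  finally show ?thesis .
qed

section \<open>Positive semidefiniteness in terms of the forms\<close>

lemma min_mat_form:
  assumes "v \<in> carrier_vec n"
  shows "v \<bullet> (min_mat n c *\<^sub>v v) = 2 * min_form n (($) v) - c * norm_form n (($) v)"
proof -
  have "v \<bullet> (min_mat n c *\<^sub>v v) = (\<Sum>i<n. v $ i *
      (\<Sum>j<n. (2 * real (min (i + 1) (j + 1)) - c - c * of_bool (i = j)) * v $ j))"
    using assms unfolding min_mat_def scalar_prod_def
    by (auto simp: scalar_prod_def atLeast0LessThan intro!: sum.cong)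
  also have "\<dots> = (\<Sum>i<n. \<Sum>j<n. 2 * (real (min (i + 1) (j + 1)) * v $ i * v $ j)
      - c * (v $ i * v $ j) - c * (if i = j then (v $ i)\<^sup>2 else 0))"
    by (auto simp: sum_distrib_left algebra_simps power2_eq_square intro!: sum.cong)
  also have "\<dots> = 2 * min_form n (($) v) - c * (\<Sum>i<n. \<Sum>j<n. v $ i * v $ j)
      - c * (\<Sum>i<n. (v $ i)\<^sup>2)"
    by (simp add: min_form_def sum_subtractf sum_distrib_left[symmetric])
  also have "(\<Sum>i<n. \<Sum>j<n. v $ i * v $ j) = (\<Sum>i<n. v $ i)\<^sup>2"
    by (simp only: power2_eq_square sum_product)
  finally show ?thesis
    by (simp add: norm_form_def algebra_simps)
qed

lemma pos_semidef_min_mat_iff: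
  "pos_semidef (min_mat n c) \<longleftrightarrow> (\<forall>g. c * norm_form n g \<le> 2 * min_form n g)"
proof -
  have dims: "dim_row (min_mat n c) = n" "dim_col (min_mat n c) = n"
    by (simp_all add: min_mat_def)
  have sym: "transpose_mat (min_mat n c) = min_mat n c"
    by (rule eq_matI) (auto simp: min_mat_def min.commute)
  have vec: "min_form n (($) (vec n g)) = min_form n g" "norm_form n (($) (vec n g)) = norm_form n g"
    for g
    by (simp_all add: min_form_def norm_form_def)
  have "pos_semidef (min_mat n c) \<longleftrightarrow>
      (\<forall>v\<in>carrier_vec n. c * norm_form n (($) v) \<le> 2 * min_form n (($) v))"
    by (auto simp: pos_semidef_def dims sym min_mat_form)
  also have "\<dots> \<longleftrightarrow> (\<forall>g. c * norm_form n g \<le> 2 * min_form n g)"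
    using vec by (metis vec_carrier)
  finally show ?thesis .
qed

definition sphere_values :: "nat \<Rightarrow> real set" where
  "sphere_values n = {2 * min_form n g | g. norm_form n g = 1}"

lemma pos_semidef_min_mat_iff_sphere:
  "pos_semidef (min_mat n c) \<longleftrightarrow> (\<forall>t\<in>sphere_values n. c \<le> t)"
  unfolding pos_semidef_min_mat_iff
proof
  assume "\<forall>g. c * norm_form n g \<le> 2 * min_form n g"
  then show "\<forall>t\<in>sphere_values n. c \<le> t"
    by (auto simp: sphere_values_def) (metis mult.right_neutral)
next
  assume bound: "\<forall>t\<in>sphere_values n. c \<le> t"
  show "\<forall>g. c * norm_form n g \<le> 2 * min_form n g"
  proof
    fix g
    show "c * norm_form n g \<le> 2 * min_form n g"
    proof (cases "norm_form n g = 0")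
      case True
      then show ?thesis using min_form_nonneg[of n g] by simp
    next
      case False
      then have pos: "norm_form n g > 0"
        using norm_form_nonneg[of n g] by simp
      define a where "a = 1 / sqrt (norm_form n g)"
      have a: "a\<^sup>2 = 1 / norm_form n g"
        using pos by (simp add: a_def power_divide)
      then have "norm_form n (\<lambda>i. a * g i) = 1"
        using pos by (simp add: norm_form_scale)
      then have "c \<le> 2 * min_form n (\<lambda>i. a * g i)"
        using bound by (auto simp: sphere_values_def)
      then have "c \<le> 2 * min_form n g / norm_form n g"
        by (simp add: min_form_scale a)
      then show ?thesis using pos by (simp add: field_simps)
    qed
  qed
qed

lemma sphere_values_bdd_below: "bdd_below (sphere_values n)"
  by (rule bdd_belowI[of _ 0]) (auto simp: sphere_values_def min_form_nonneg)

lemma sphere_values_nonempty: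
  assumes "n \<ge> 1"
  shows "sphere_values n \<noteq> {}"
proof -
  define g :: "nat \<Rightarrow> real" where "g = (\<lambda>i. sqrt (1 / 2) * of_bool (i = 0))"
  have "{..<n} \<inter> {i. i = 0} = {0}"
    using assms by auto
  then have "(\<Sum>i<n. of_bool (i = 0)) = (1 :: real)" "(\<Sum>i<n. (of_bool (i = 0))\<^sup>2) = (1 :: real)"
    by (simp_all add: power2_eq_square flip: of_bool_conj)
  then have "norm_form n (\<lambda>i. of_bool (i = 0)) = 2"
    by (simp only: norm_form_def) simp
  then have "norm_form n g = 1"
    by (simp add: g_def norm_form_scale)
  then show ?thesis
    by (auto simp: sphere_values_def)
qed

lemma path_const_eq_Inf:
  assumes "n \<ge> 1"
  shows "path_const n = Inf (sphere_values n)"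
  unfolding path_const_def pos_semidef_min_mat_iff_sphere
  by (rule Greatest_equality)
    (auto intro: cInf_lower[OF _ sphere_values_bdd_below]
      cInf_greatest[OF sphere_values_nonempty[OF assms]])

section \<open>The QE constant in terms of the forms\<close>

lemma inner_on_path:
  "inner_on (verts (path_graph m)) f h = (\<Sum>x<m. f x * h x)"
  unfolding inner_on_def by (subst sum.eq_sum) (simp_all add: path_graph_def atLeast0LessThan)

lemma dist_op_path:
  assumes "x < m"
  shows "dist_op (path_graph m) f x = (\<Sum>y<m. \<bar>real x - real y\<bar> * f y)"
proof -
  have verts: "verts (path_graph m) = {..<m}"
    by (simp add: path_graph_def atLeast0LessThan)
  show ?thesis
    unfolding dist_op_def verts by (subst sum.eq_sum) (simp_all add: graph_dist_path assms)
qed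

lemma finsupp_path: "f \<in> finsupp (verts (path_graph m)) \<longleftrightarrow> (\<forall>x\<ge>m. f x = 0)"
proof -
  have "{x. f x \<noteq> 0} \<subseteq> {0..<m} \<Longrightarrow> finite {x. f x \<noteq> 0}"
    by (rule finite_subset) auto
  then show ?thesis
    by (fastforce simp: finsupp_def path_graph_def not_le)
qed

text \<open>In the expansion \<open>\<bar>x - y\<bar> = x + y - 2 min x y\<close> the first two parts of the double sum factor
  through \<open>\<Sum>f = 0\<close>, and the terms of the third with \<open>x = 0\<close> or \<open>y = 0\<close> vanish.\<close>

lemma path_dist_form:
  assumes "(\<Sum>x<Suc n. f x) = 0"
  shows "(\<Sum>x<Suc n. f x * (\<Sum>y<Suc n. \<bar>real x - real y\<bar> * f y)) = - 2 * min_form n (f \<circ> Suc)"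
proof -
  have "(\<Sum>x<Suc n. f x * (\<Sum>y<Suc n. \<bar>real x - real y\<bar> * f y)) =
      (\<Sum>x<Suc n. \<Sum>y<Suc n. (real x * f x) * f y + f x * (real y * f y)
        - 2 * (real (min x y) * f x * f y))"
    unfolding sum_distrib_left by (intro sum.cong refl) (auto simp: min_def algebra_simps)
  also have "\<dots> = (\<Sum>x<Suc n. real x * f x) * (\<Sum>y<Suc n. f y)
      + (\<Sum>x<Suc n. f x) * (\<Sum>y<Suc n. real y * f y)
      - 2 * (\<Sum>x<Suc n. \<Sum>y<Suc n. real (min x y) * f x * f y)"
    unfolding sum.distrib sum_subtractf sum_product sum_distrib_left[of 2] by (rule refl)
  also have "\<dots> = - 2 * (\<Sum>x<Suc n. \<Sum>y<Suc n. real (min x y) * f x * f y)"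
    by (simp only: assms)
  also have "(\<Sum>x<Suc n. \<Sum>y<Suc n. real (min x y) * f x * f y) = min_form n (f \<circ> Suc)"
    by (simp add: sum.lessThan_Suc_shift min_form_def del: sum.lessThan_Suc)
  finally show ?thesis .
qed

text \<open>The summand \<open>(\<Sum>g)\<^sup>2\<close> of the norm form is the square of the value at the vertex \<open>0\<close>.\<close>

lemma path_norm_form:
  assumes "(\<Sum>x<Suc n. f x) = 0"
  shows "(\<Sum>x<Suc n. f x * f x) = norm_form n (f \<circ> Suc)"
proof -
  have "f 0 = - (\<Sum>i<n. f (Suc i))"
    using assms by (simp add: sum.lessThan_Suc_shift del: sum.lessThan_Suc)
  then show ?thesis
    by (simp add: sum.lessThan_Suc_shift norm_form_def power2_eq_square del: sum.lessThan_Suc)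
qed

lemma QEC_path_eq_Sup: "QEC (path_graph (n + 1)) = Sup ((\<lambda>t. ereal (- t)) ` sphere_values n)"
proof -
  let ?V = "verts (path_graph (n + 1))"
  have inner: "inner_on ?V f (dist_op (path_graph (n + 1)) f) = - 2 * min_form n (f \<circ> Suc)"
    "inner_on ?V f f = norm_form n (f \<circ> Suc)"
    if "inner_on ?V (\<lambda>_. 1) f = 0" for f
  proof -
    have zero: "(\<Sum>x<Suc n. f x) = 0"
      using that by (simp add: inner_on_path)
    show "inner_on ?V f (dist_op (path_graph (n + 1)) f) = - 2 * min_form n (f \<circ> Suc)"
      using path_dist_form[OF zero] by (simp add: inner_on_path dist_op_path)
    show "inner_on ?V f f = norm_form n (f \<circ> Suc)"
      using path_norm_form[OF zero] by (simp add: inner_on_path)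
  qed
  have "{ereal (inner_on ?V f (dist_op (path_graph (n + 1)) f)) | f.
      f \<in> finsupp ?V \<and> inner_on ?V f f = 1 \<and> inner_on ?V (\<lambda>_. 1) f = 0}
      = (\<lambda>t. ereal (- t)) ` sphere_values n" (is "?A = ?B")
  proof (intro equalityI subsetI)
    fix z assume "z \<in> ?A"
    then obtain f where f: "z = ereal (inner_on ?V f (dist_op (path_graph (n + 1)) f))"
      "inner_on ?V f f = 1" "inner_on ?V (\<lambda>_. 1) f = 0"
      by blast
    then have "norm_form n (f \<circ> Suc) = 1"
      using inner(2)[OF f(3)] by simp
    then have "2 * min_form n (f \<circ> Suc) \<in> sphere_values n"
      by (auto simp: sphere_values_def)
    with f inner(1)[OF f(3)] show "z \<in> ?B"
      by (auto intro!: image_eqI)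
  next
    fix z assume "z \<in> ?B"
    then obtain g where g: "z = ereal (- (2 * min_form n g))" "norm_form n g = 1"
      by (auto simp: sphere_values_def)
    \<comment> \<open>the extension of \<open>g\<close> to the vertex \<open>0\<close> that is forced by the vanishing of the sum\<close>
    define f where "f x = (case x of 0 \<Rightarrow> - (\<Sum>i<n. g i) | Suc i \<Rightarrow> if i < n then g i else 0)" for x
    have zero: "inner_on ?V (\<lambda>_. 1) f = 0"
      by (simp add: inner_on_path f_def sum.lessThan_Suc_shift del: sum.lessThan_Suc)
    have forms: "min_form n (f \<circ> Suc) = min_form n g" "norm_form n (f \<circ> Suc) = norm_form n g"
      by (simp_all add: min_form_def norm_form_def f_def)
    have "f \<in> finsupp ?V"
      unfolding finsupp_path by (auto simp: f_def split: nat.split)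
    then show "z \<in> ?A"
      using zero g inner[OF zero] by (auto simp: forms intro!: exI[of _ f])
  qed
  then show ?thesis
    by (simp only: QEC_def)
qed

lemma QEC_path:
  assumes "n \<ge> 1"
  shows "QEC (path_graph (n + 1)) = ereal (- Inf (sphere_values n))"
  unfolding QEC_path_eq_Sup
proof (rule antisym)
  show "Sup ((\<lambda>t. ereal (- t)) ` sphere_values n) \<le> ereal (- Inf (sphere_values n))"
    by (auto intro!: Sup_least cInf_lower sphere_values_bdd_below)
next
  show "ereal (- Inf (sphere_values n)) \<le> Sup ((\<lambda>t. ereal (- t)) ` sphere_values n)"
  proof (rule le_Sup_iff[THEN iffD2], intro allI impI)
    fix y assume "y < ereal (- Inf (sphere_values n))"
    then show "\<exists>a\<in>(\<lambda>t. ereal (- t)) ` sphere_values n. y < a"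
    proof (cases y)
      case (real r)
      then have "Inf (sphere_values n) < - r"
        using \<open>y < ereal (- Inf (sphere_values n))\<close> by simp
      then obtain t where "t \<in> sphere_values n" "t < - r"
        using cInf_lessD[OF sphere_values_nonempty[OF assms]] by blast
      with real show ?thesis by force
    next
      case MInf
      then show ?thesis using sphere_values_nonempty[OF assms] by auto
    qed simp
  qed
qed

theorem proposition5p4:
  fixes n :: nat
  assumes "n \<ge> 1"
  shows "pos_semidef (min_mat n (path_const n))
    \<and> (\<forall>c. pos_semidef (min_mat n c) \<longrightarrow> c \<le> path_const n)
    \<and> QEC (path_graph (n + 1)) = ereal (- path_const n)"
  unfolding path_const_eq_Inf[OF assms] QEC_path[OF assms] pos_semidef_min_mat_iff_sphere
  by (auto intro: cInf_lower[OF _ sphere_values_bdd_below]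
      cInf_greatest[OF sphere_values_nonempty[OF assms]])

end
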